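(* Let $p,q,r,s\geq1$ be real numbers satisfying $\frac1p+\frac1q+\frac1r=2+\frac1s$, and let $\gamma(y)=e^{-\frac12y^2}$ (which belongs to $L_r(\mathbb{R})$). If $f\in L_p(\mathbb{R})$ and $g\in L_q(\mathbb{R})$, then the convolution $f\underset{T_c}{\overset{\gamma}{*}}g$ belongs to $L_s(\mathbb{R})$, and $$\big\|f\underset{T_c}{\overset{\gamma}{*}}g\big\|_{L_s(\mathbb{R})}\leq\frac{1}{2\pi}\left(\sqrt{\frac{2\pi}{r}}\right)^{1/r}\|f\|_{L_p(\mathbb{R})}\|g\|_{L_q(\mathbb{R})}.$$
   Context: For functions $f,g$ on $\mathbb{R}$, the iterated Fourier-cosine convolution with Gaussian weight $\gamma(y)=e^{-\frac12y^2}$ is $$\big(f\underset{T_c}{\overset{\gamma}{*}}g\big)(x):=\frac{1}{8\pi}\int_{\mathbb{R}^2}f(u)g(v)G(x,u,v)\,du\,dv,\quad x\in\mathbb{R},$$ where $$G(x,u,v)=e^{-\frac12(x+u+v)^2}+e^{-\frac12(x+u-v)^2}+e^{-\frac12(x-u+v)^2}+e^{-\frac12(x-u-v)^2}.$$ *)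

theory Defs
  imports "HOL-Analysis.Analysis"
begin

text \<open>
  \<^term>\<open>Lp_space p\<close> is the space of Lebesgue measurable functions on the real line whose
  \<open>p\<close>-th power is integrable, for a real exponent \<open>p \<ge> 1\<close>. Its elements are
  functions, not classes of functions that agree almost everywhere.
\<close>

definition Lp_space :: "real \<Rightarrow> (real \<Rightarrow> 'a::real_normed_vector) set" where
  "Lp_space p =
     {f \<in> borel_measurable lebesgue. integrable lebesgue (\<lambda>x. norm (f x) powr p)}"

definition Lp_norm :: "real \<Rightarrow> (real \<Rightarrow> 'a::real_normed_vector) \<Rightarrow> real" where
  "Lp_norm p f = (LINT x|lebesgue. norm (f x) powr p) powr (1 / p)"

definition gauss_weight :: "real \<Rightarrow> real" where
  "gauss_weight y = exp (- (1 / 2) * y\<^sup>2)"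

definition conv_kernel :: "real \<Rightarrow> real \<Rightarrow> real \<Rightarrow> real" where
  "conv_kernel x u v =
     gauss_weight (x + u + v) + gauss_weight (x + u - v) +
     gauss_weight (x - u + v) + gauss_weight (x - u - v)"

text \<open>
  The scalars are a type \<open>'a\<close> so that the definitions apply to both real and complex valued
  functions. The integral below is the Lebesgue integral over the plane; the Bochner integral
  of a function that is not integrable is \<open>0\<close> by convention, so integrability of
  \<^term>\<open>cos_conv_integrand f g x\<close> is what says that the convolution exists at \<open>x\<close>.
\<close>

definition cos_conv_integrand ::
    "(real \<Rightarrow> 'a::real_normed_field) \<Rightarrow> (real \<Rightarrow> 'a) \<Rightarrow> real \<Rightarrow> real \<times> real \<Rightarrow> 'a" where
  "cos_conv_integrand f g x = (\<lambda>(u, v). conv_kernel x u v *\<^sub>R (f u * g v))"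

definition cos_conv ::
    "(real \<Rightarrow> 'a::{real_normed_field, banach, second_countable_topology}) \<Rightarrow>
     (real \<Rightarrow> 'a) \<Rightarrow> real \<Rightarrow> 'a" where
  "cos_conv f g x =
     (1 / (8 * pi)) *\<^sub>R integral\<^sup>L lebesgue (cos_conv_integrand f g x)"

end

theory Submission
  imports Defs "HOL-Probability.Distributions"
begin

text \<open>
  Put \<open>F = \<bar>f\<bar>\<^sup>p\<close>, \<open>G = \<bar>g\<bar>\<^sup>q\<close>, \<open>H = \<gamma>\<^sup>r\<close> and \<open>a = 1/p\<close>, \<open>b = 1/q\<close>, \<open>c = 1/r\<close>, \<open>d = 1/s\<close>.
  Since \<open>a + b + c = 2 + d\<close>, the product \<open>F\<^sup>a G\<^sup>b H\<^sup>c\<close> equals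
  \<open>(FGH)\<^sup>d (FG)\<^bsup>1-c\<^esup> (FH)\<^bsup>1-b\<^esup> (GH)\<^bsup>1-a\<^esup>\<close> with exponents summing to 1. Hoelder's inequality in
  \<open>(u, v)\<close> bounds each of the four terms of the convolution pointwise, the last three factors
  contributing products of norms that do not depend on \<open>x\<close>; boundedness of \<open>\<gamma>\<close> makes the first
  factor finite at every \<open>x\<close>. Raising to the power \<open>s\<close> and integrating over \<open>x\<close> gives a Young
  inequality for each term, and convexity of \<open>t \<mapsto> t\<^sup>s\<close> averages the four.
\<close>

section \<open>Weighted means and Hoelder's inequality for finitely many factors\<close>

text \<open>The tangent bound \<open>ln t \<le> t - 1\<close> is taken at
  \<open>t = y i / P\<close>, with \<open>P\<close> the product on the left, and averaged with the
  weights \<open>w\<close>. Since \<open>ln P\<close> is the weighted mean of the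
  \<open>ln (y i)\<close>, the logarithms cancel and leave
  \<open>1 \<le> (\<Sum>i\<in>I. w i * y i) / P\<close>. A zero among the \<open>y i\<close> is
  split off first, because \<open>ln\<close> needs positive arguments.\<close>

lemma weighted_AM_GM:
  fixes w y :: "'i \<Rightarrow> real"
  assumes "finite I" and w: "\<And>i. i \<in> I \<Longrightarrow> 0 \<le> w i" "sum w I = 1"
    and y: "\<And>i. i \<in> I \<Longrightarrow> 0 \<le> y i"
  shows "(\<Prod>i\<in>I. y i powr w i) \<le> (\<Sum>i\<in>I. w i * y i)"
proof (cases "\<exists>i\<in>I. y i = 0")
  case True
  then have "(\<Prod>i\<in>I. y i powr w i) = 0"
    using assms(1) by (auto intro!: prod_zero)
  then show ?thesis
    using w(1) y by (simp add: sum_nonneg)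
next
  case False
  define P where "P = (\<Prod>i\<in>I. y i powr w i)"
  have pos: "0 < y i" if "i \<in> I" for i
    using False y that by (metis less_eq_real_def)
  have P: "0 < P"
    unfolding P_def by (intro prod_pos) (force dest: pos)
  have lnP: "ln P = (\<Sum>i\<in>I. w i * ln (y i))"
    unfolding P_def using assms(1) by (subst ln_prod) (force simp: ln_powr dest: pos)+
  have "w i * (1 + ln (y i) - ln P) \<le> w i * (y i / P)" if "i \<in> I" for i
    using ln_le_minus_one[of "y i / P"] pos[OF that] P w(1)[OF that]
    by (intro mult_left_mono) (auto simp: ln_div)
  then have "(\<Sum>i\<in>I. w i * (1 + ln (y i) - ln P)) \<le> (\<Sum>i\<in>I. w i * (y i / P))"
    by (rule sum_mono)
  moreover have "(\<Sum>i\<in>I. w i * (1 + ln (y i) - ln P)) = 1"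
  proof -
    have "(\<Sum>i\<in>I. w i * (1 + ln (y i) - k)) = (\<Sum>i\<in>I. w i) + (\<Sum>i\<in>I. w i * ln (y i)) - (\<Sum>i\<in>I. w i) * k" for k
      by (simp add: algebra_simps sum.distrib sum_subtractf sum_distrib_left)
    then show ?thesis
      using w(2) by (simp only: lnP)
  qed
  moreover have "(\<Sum>i\<in>I. w i * (y i / P)) = (\<Sum>i\<in>I. w i * y i) / P"
    by (simp add: sum_divide_distrib)
  ultimately have "1 \<le> (\<Sum>i\<in>I. w i * y i) / P"
    by simp
  then show ?thesis
    using P by (simp add: P_def[symmetric])
qed

text \<open>Jensen's inequality for \<open>t powr s\<close>. Each \<open>x j\<close> is compared
  with the mean \<open>m\<close> by Young's inequality; summing over \<open>J\<close> gives
  \<open>m powr s\<close> on both sides, and the term with factor \<open>1 - 1 / s\<close> is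
  absorbed on the left.\<close>

lemma powr_mean_le:
  fixes x :: "'i \<Rightarrow> real"
  assumes "finite J" "J \<noteq> {}" and x: "\<And>j. j \<in> J \<Longrightarrow> 0 \<le> x j" and s: "1 \<le> s"
  shows "((\<Sum>j\<in>J. x j) / card J) powr s \<le> (\<Sum>j\<in>J. x j powr s) / card J"
proof (cases "(\<Sum>j\<in>J. x j) = 0")
  case True
  then show ?thesis by (simp add: sum_nonneg)
next
  case False
  define m where "m = (\<Sum>j\<in>J. x j) / card J"
  have c: "0 < real (card J)" using assms(1,2) by (simp add: card_gt_0_iff)
  have m: "0 < m"
  proof -
    have "0 < (\<Sum>j\<in>J. x j)"
      using False sum_nonneg[of J x, OF x] by simp
    then show ?thesis
      using c by (simp add: m_def)
  qed
  have young: "x j * m powr (s - 1) \<le> x j powr s / s + (1 - 1 / s) * m powr s" if "j \<in> J" for j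
  proof -
    \<comment> \<open>Young's inequality is AM-GM for two points, indexed by \<open>bool\<close>,
      with weights \<open>1 / s\<close> and \<open>1 - 1 / s\<close>; the second factor becomes
      \<open>m powr (s - 1)\<close>.\<close>
    let ?y = "\<lambda>b. if b then x j powr s else m powr s"
    let ?w = "\<lambda>b. if b then 1 / s else 1 - 1 / s"
    have "(\<Prod>b\<in>UNIV. ?y b powr ?w b) \<le> (\<Sum>b\<in>UNIV. ?w b * ?y b)"
      using s by (intro weighted_AM_GM) (auto simp: UNIV_bool)
    moreover have "s * (1 - 1 / s) = s - 1" using s by (simp add: field_simps)
    ultimately show ?thesis
      using s x[OF that] by (simp add: UNIV_bool powr_powr mult.commute)
  qed
  have "(\<Sum>j\<in>J. x j * m powr (s - 1)) \<le> (\<Sum>j\<in>J. x j powr s / s + (1 - 1 / s) * m powr s)"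
    using young by (rule sum_mono)
  also have "\<dots> = (\<Sum>j\<in>J. x j powr s) / s + card J * ((1 - 1 / s) * m powr s)"
    by (simp add: sum.distrib sum_divide_distrib)
  also have "(\<Sum>j\<in>J. x j * m powr (s - 1)) = card J * m powr s"
  proof -
    have "(\<Sum>j\<in>J. x j) = card J * m"
      using c by (simp add: m_def)
    then show ?thesis
      using m powr_mult_base[of m "s - 1"] by (simp add: mult.assoc flip: sum_distrib_right)
  qed
  finally have "card J * m powr s \<le> (\<Sum>j\<in>J. x j powr s)"
    using s by (simp add: field_simps)
  then show ?thesis
    using c by (simp add: m_def[symmetric] field_simps)
qed

text \<open>Zero weights are harmless: \<open>0 powr 0 = 0\<close>, so a vanishing factor kills both sides.\<close>

lemma nn_integral_Holder_prod:
  fixes A :: "'i \<Rightarrow> 'x \<Rightarrow> real"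
  assumes "finite I" and w: "\<And>i. i \<in> I \<Longrightarrow> 0 \<le> w i" "sum w I = 1"
    and A [measurable]: "\<And>i. i \<in> I \<Longrightarrow> A i \<in> borel_measurable M"
    and A0: "\<And>i x. i \<in> I \<Longrightarrow> 0 \<le> A i x"
    and N0: "\<And>i. i \<in> I \<Longrightarrow> 0 \<le> N i"
    and N: "\<And>i. i \<in> I \<Longrightarrow> (\<integral>\<^sup>+x. A i x \<partial>M) \<le> ennreal (N i)"
  shows "(\<integral>\<^sup>+x. (\<Prod>i\<in>I. A i x powr w i) \<partial>M) \<le> ennreal (\<Prod>i\<in>I. N i powr w i)"
\<comment> \<open>If some \<open>N i\<close> is zero, \<open>A i\<close> vanishes almost everywhere
  and so does the product. Otherwise every factor can be divided by its bound.\<close>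
proof (cases "\<exists>i\<in>I. N i = 0")
  case True
  then obtain i where i: "i \<in> I" "N i = 0" by blast
  then have "(\<integral>\<^sup>+x. A i x \<partial>M) = 0" using N[of i] by simp
  then have "AE x in M. A i x = 0"
    using A0[OF i(1)] A[OF i(1)] by (simp add: nn_integral_0_iff_AE order_antisym_conv)
  then have "AE x in M. ennreal (\<Prod>i\<in>I. A i x powr w i) = 0"
  proof eventually_elim
    case (elim x)
    then have "(\<Prod>i\<in>I. A i x powr w i) = 0"
      using i assms(1) by (auto intro!: prod_zero)
    then show ?case by simp
  qed
  then have "(\<integral>\<^sup>+x. (\<Prod>i\<in>I. A i x powr w i) \<partial>M) = (\<integral>\<^sup>+x. 0 \<partial>M)"
    by (rule nn_integral_cong_AE)
  then show ?thesis by simp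
next
  case False
  define P where "P = (\<Prod>i\<in>I. N i powr w i)"
  have pos: "0 < N i" if "i \<in> I" for i
    using False N0 that by (metis less_eq_real_def)
  have P: "0 < P"
    unfolding P_def by (intro prod_pos) (force dest: pos)
  \<comment> \<open>AM-GM is applied to the normalised values \<open>A i x / N i\<close> and scaled
    back by \<open>P\<close>. After integration the term for \<open>i\<close> is at most
    \<open>P * w i\<close>, and the weights sum to 1.\<close>
  have "(\<Prod>i\<in>I. A i x powr w i) \<le> (\<Sum>i\<in>I. P * w i / N i * A i x)" for x
  proof -
    have "(\<Prod>i\<in>I. (A i x / N i) powr w i) \<le> (\<Sum>i\<in>I. w i * (A i x / N i))"
      using w A0 pos by (intro weighted_AM_GM assms(1)) (auto simp: less_imp_le)
    moreover have "(\<Prod>i\<in>I. (A i x / N i) powr w i) = (\<Prod>i\<in>I. A i x powr w i) / P"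
      unfolding P_def prod_dividef[symmetric] using A0 pos
      by (intro prod.cong) (auto simp: powr_divide less_imp_le)
    ultimately show ?thesis
      using P by (simp add: field_simps sum_distrib_left)
  qed
  then have "(\<integral>\<^sup>+x. (\<Prod>i\<in>I. A i x powr w i) \<partial>M) \<le> (\<integral>\<^sup>+x. (\<Sum>i\<in>I. ennreal (P * w i / N i) * ennreal (A i x)) \<partial>M)"
    using w A0 pos P
    by (intro nn_integral_mono)
      (auto simp: ennreal_mult[symmetric] sum_ennreal less_imp_le intro!: ennreal_leI)
  also have "\<dots> = (\<Sum>i\<in>I. ennreal (P * w i / N i) * (\<integral>\<^sup>+x. A i x \<partial>M))"
    by (simp add: nn_integral_sum nn_integral_cmult)
  also have "\<dots> \<le> (\<Sum>i\<in>I. ennreal (P * w i / N i) * ennreal (N i))"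
    by (intro sum_mono mult_left_mono N) auto
  also have "\<dots> = (\<Sum>i\<in>I. ennreal (P * w i))"
  proof (rule sum.cong)
    fix i assume "i \<in> I"
    then have "0 < N i" "0 \<le> w i" using pos w by auto
    then show "ennreal (P * w i / N i) * ennreal (N i) = ennreal (P * w i)"
      using P by (simp add: ennreal_mult[symmetric])
  qed simp
  also have "\<dots> = ennreal (\<Sum>i\<in>I. P * w i)"
    using w P by (simp add: sum_ennreal)
  also have "(\<Sum>i\<in>I. P * w i) = P"
    using w(2) by (simp flip: sum_distrib_left)
  finally show ?thesis by (simp add: P_def)
qed

section \<open>Measurable representatives for a completed measure\<close>

text \<open>A countable basis leaves only countably many preimages to repair. Each is a measurable
  main part together with a subset of a null set, and the union \<open>Z\<close> of these null sets
  is still null, so changing \<open>f\<close> on \<open>Z\<close> suffices.\<close>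

lemma completion_ex_borel_measurable_second_countable:
  fixes f :: "'x \<Rightarrow> 'b::second_countable_topology"
  assumes f: "f \<in> borel_measurable (completion M)"
  shows "\<exists>g\<in>borel_measurable M. AE x in M. f x = g x"
proof -
  obtain B :: "'b set set" where B: "countable B" "topological_basis B"
    using ex_countable_basis by blast
  have pre: "f -` X \<inter> space M \<in> sets (completion M)" if "X \<in> B" for X
    using measurable_sets[OF f, of X] topological_basis_open[OF B(2) that] by simp
  have "\<exists>N. \<forall>X\<in>B. N X \<in> null_sets M \<and> null_part M (f -` X \<inter> space M) \<subseteq> N X"
    using null_part[OF pre] by (intro bchoice) auto
  then obtain N where N: "\<And>X. X \<in> B \<Longrightarrow> N X \<in> null_sets M"
      "\<And>X. X \<in> B \<Longrightarrow> null_part M (f -` X \<inter> space M) \<subseteq> N X" by blast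
  define Z where "Z = (\<Union>X\<in>B. N X)"
  have Z: "Z \<in> null_sets M"
    unfolding Z_def using B(1) N(1) by (intro null_sets_UN') auto
  \<comment> \<open>Any constant value on \<open>Z\<close> works: a preimage under \<open>g\<close>
    then contains all of \<open>Z\<close> or none of it.\<close>
  define g where "g x = (if x \<in> Z then undefined else f x)" for x
  have "g -` X \<inter> space M \<in> sets M" if X: "X \<in> B" for X
  proof -
    let ?m = "main_part M (f -` X \<inter> space M)"
    have "f -` X \<inter> space M - Z = ?m - Z"
      using main_part_null_part_Un[OF pre[OF X]] N(2)[OF X] X by (auto simp: Z_def)
    moreover have "g -` X \<inter> space M = (f -` X \<inter> space M - Z) \<union> (if undefined \<in> X then Z else {})"
      using null_setsD2[OF Z, THEN sets.sets_into_space] by (auto simp: g_def split: if_splits)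
    ultimately show ?thesis
      using null_setsD2[OF Z] main_part_sets[OF pre[OF X]] by auto
  qed
  then have "g \<in> borel_measurable M"
    by (subst borel_eq_countable_basis[OF B]) (auto intro!: measurable_measure_of)
  moreover have "AE x in M. f x = g x"
    using AE_not_in[OF Z] by eventually_elim (simp add: g_def)
  ultimately show ?thesis by blast
qed

section \<open>Young's inequality for one choice of signs\<close>

text \<open>Each variable occurs in three of the four factors, and \<open>eq\<close> makes its
  exponents there add up to \<open>a\<close>, \<open>b\<close> or \<open>c\<close>. If a variable is
  0, both sides vanish because \<open>0 powr t = 0\<close> for every \<open>t\<close>.\<close>

lemma powr_Young_split:
  fixes x y z :: real
  assumes "0 \<le> x" "0 \<le> y" "0 \<le> z" and eq: "a + b + c = 2 + d"
  shows "(x * y * z) powr d * (x * y) powr (1 - c) * (x * z) powr (1 - b) * (y * z) powr (1 - a)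
    = x powr a * y powr b * z powr c"
proof (cases "x = 0 \<or> y = 0 \<or> z = 0")
  case True
  then show ?thesis by auto
next
  case False
  have "a = d + (1 - c) + (1 - b)" "b = d + (1 - c) + (1 - a)" "c = d + (1 - b) + (1 - a)"
    using eq by auto
  then have "x powr a = x powr d * x powr (1 - c) * x powr (1 - b)"
    "y powr b = y powr d * y powr (1 - c) * y powr (1 - a)"
    "z powr c = z powr d * z powr (1 - b) * z powr (1 - a)"
    by (metis powr_add)+
  then show ?thesis
    using assms by (simp add: powr_mult)
qed

lemma nn_integral_lborel_reflect:
  fixes h :: "real \<Rightarrow> ennreal"
  assumes "h \<in> borel_measurable borel" "\<bar>c\<bar> = 1"
  shows "(\<integral>\<^sup>+x. h (t + c * x) \<partial>lborel) = (\<integral>\<^sup>+x. h x \<partial>lborel)"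
  using nn_integral_real_affine[OF assms(1), of c t] assms(2) by (auto simp: one_ennreal_def[symmetric])

text \<open>With \<open>\<epsilon>\<close> and \<open>\<delta>\<close> equal to 1 or -1 these are
  the four terms of the convolution, up to the constant factor. Values in \<open>ennreal\<close>
  make the integral meaningful before integrability is known.\<close>

definition signed_conv ::
    "real \<Rightarrow> real \<Rightarrow> (real \<Rightarrow> real) \<Rightarrow> (real \<Rightarrow> real) \<Rightarrow> (real \<Rightarrow> real) \<Rightarrow> real \<Rightarrow> ennreal" where
  "signed_conv \<epsilon> \<delta> f g h x =
     (\<integral>\<^sup>+z. f (fst z) * g (snd z) * h (x + \<epsilon> * fst z + \<delta> * snd z) \<partial>(lborel \<Otimes>\<^sub>M lborel))"

context
  fixes F G H :: "real \<Rightarrow> real" and A B C K a b c s \<epsilon> \<delta> :: real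
  assumes meas [measurable]: "F \<in> borel_measurable borel" "G \<in> borel_measurable borel"
      "H \<in> borel_measurable borel"
    and nonneg: "\<And>x. 0 \<le> F x" "\<And>x. 0 \<le> G x" "\<And>x. 0 \<le> H x"
    and bound: "\<And>x. H x \<le> K"
    and ABC: "0 \<le> A" "0 \<le> B" "0 \<le> C"
    and int: "(\<integral>\<^sup>+x. F x \<partial>lborel) = ennreal A" "(\<integral>\<^sup>+x. G x \<partial>lborel) = ennreal B"
      "(\<integral>\<^sup>+x. H x \<partial>lborel) = ennreal C"
    and exps: "a \<le> 1" "b \<le> 1" "c \<le> 1" "1 \<le> s" "a + b + c = 2 + 1 / s"
    and signs: "\<bar>\<epsilon>\<bar> = 1" "\<bar>\<delta>\<bar> = 1"
begin

private definition "arg x z = x + \<epsilon> * fst z + \<delta> * snd z" for x :: real and z :: "real \<times> real"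

private lemma arg_measurable [measurable]:
  "(\<lambda>z. arg x z) \<in> borel_measurable (borel \<Otimes>\<^sub>M borel)"
  "(\<lambda>x. arg x z) \<in> borel_measurable borel"
  "(\<lambda>w. arg (fst w) (snd w)) \<in> borel_measurable (borel \<Otimes>\<^sub>M (borel \<Otimes>\<^sub>M borel))"
  unfolding arg_def by measurable

text \<open>The integral of the first Hoelder factor, the only one of the four whose integral may
  vary with \<open>x\<close>.\<close>

private definition "J x = (\<integral>\<^sup>+z. F (fst z) * G (snd z) * H (arg x z) \<partial>(lborel \<Otimes>\<^sub>M lborel))"

private lemma J_measurable [measurable]: "J \<in> borel_measurable borel"
  unfolding J_def by measurable

private lemma int_FG: "(\<integral>\<^sup>+z. F (fst z) * G (snd z) \<partial>(lborel \<Otimes>\<^sub>M lborel)) = ennreal (A * B)"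
  by (subst lborel.nn_integral_fst[symmetric])
    (auto simp: ennreal_mult nonneg ABC nn_integral_cmult nn_integral_multc int)

text \<open>For fixed \<open>u\<close> the inner integral over \<open>v\<close> sees
  \<open>H\<close> only through a translation and a possible reflection, so \<open>x\<close> drops
  out. For \<open>G\<close> and \<open>H\<close> the same works with \<open>u\<close> as the inner
  variable.\<close>

private lemma int_FH: "(\<integral>\<^sup>+z. F (fst z) * H (arg x z) \<partial>(lborel \<Otimes>\<^sub>M lborel)) = ennreal (A * C)"
  using nn_integral_lborel_reflect[of "\<lambda>x. ennreal (H x)" \<delta>] signs
  by (subst lborel.nn_integral_fst[symmetric])
    (auto simp: ennreal_mult nonneg ABC nn_integral_cmult nn_integral_multc int arg_def)

private lemma int_GH: "(\<integral>\<^sup>+z. G (snd z) * H (arg x z) \<partial>(lborel \<Otimes>\<^sub>M lborel)) = ennreal (B * C)"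
proof -
  have "(\<integral>\<^sup>+u. H (x + \<epsilon> * u + \<delta> * v) \<partial>lborel) = ennreal C" for v
    using nn_integral_lborel_reflect[of "\<lambda>x. ennreal (H x)" \<epsilon> "x + \<delta> * v"] signs int
    by (simp add: algebra_simps)
  then show ?thesis
    by (subst lborel_pair.nn_integral_snd[symmetric])
      (auto simp: ennreal_mult nonneg ABC nn_integral_cmult nn_integral_multc int arg_def)
qed

text \<open>By Tonelli \<open>x\<close> is integrated first; it enters only as a translation in
  \<open>H\<close>, which contributes \<open>C\<close> for every \<open>z\<close>.\<close>

private lemma int_J: "(\<integral>\<^sup>+x. J x \<partial>lborel) = ennreal (A * B * C)"
proof -
  have H: "(\<integral>\<^sup>+x. H (arg x z) \<partial>lborel) = ennreal C" for z
    using nn_integral_lborel_reflect[of "\<lambda>x. ennreal (H x)" 1 "\<epsilon> * fst z + \<delta> * snd z"] int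
    by (simp add: arg_def algebra_simps)
  interpret P: pair_sigma_finite "lborel :: real measure" "lborel \<Otimes>\<^sub>M lborel :: (real \<times> real) measure"
    unfolding lborel_prod by unfold_locales
  have "(\<integral>\<^sup>+x. J x \<partial>lborel)
      = (\<integral>\<^sup>+z. (\<integral>\<^sup>+x. F (fst z) * G (snd z) * H (arg x z) \<partial>lborel) \<partial>(lborel \<Otimes>\<^sub>M lborel))"
    unfolding J_def by (rule P.Fubini'[symmetric]) measurable
  also have "\<dots> = (\<integral>\<^sup>+z. F (fst z) * G (snd z) * ennreal C \<partial>(lborel \<Otimes>\<^sub>M lborel))"
    by (simp add: ennreal_mult nonneg nn_integral_cmult H)
  also have "\<dots> = ennreal (A * B) * ennreal C"
    by (subst nn_integral_multc) (simp_all add: int_FG)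
  finally show ?thesis
    using ABC by (simp add: ennreal_mult)
qed

text \<open>The bound \<open>K\<close> gives finiteness at every \<open>x\<close>; the finite
  integral of \<open>J\<close> alone would give it only almost everywhere.\<close>

private lemma J_finite: "J x < \<infinity>"
proof -
  have "J x \<le> (\<integral>\<^sup>+z. ennreal (F (fst z) * G (snd z)) * ennreal K \<partial>(lborel \<Otimes>\<^sub>M lborel))"
    unfolding J_def using nonneg bound order.trans[OF nonneg(3) bound]
    by (intro nn_integral_mono) (auto simp: ennreal_mult[symmetric] intro!: ennreal_leI mult_left_mono)
  also have "\<dots> = ennreal (A * B) * ennreal K"
    by (subst nn_integral_multc) (simp_all add: int_FG)
  also have "\<dots> < \<infinity>" by (simp add: ennreal_mult_less_top)
  finally show ?thesis .
qed

private abbreviation "T \<equiv> signed_conv \<epsilon> \<delta> (\<lambda>u. F u powr a) (\<lambda>v. G v powr b) (\<lambda>y. H y powr c)"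

private definition "Y = (A * B) powr (1 - c) * (A * C) powr (1 - b) * (B * C) powr (1 - a)"

private lemma T_le: "T x \<le> ennreal (enn2real (J x) powr (1 / s) * Y)"
proof -
  \<comment> \<open>The lists encode the four Hoelder factors, the bounds of their integrals and
    their exponents. The exponents sum to 1 because \<open>a + b + c = 2 + 1 / s\<close>.\<close>
  let ?A = "\<lambda>i z. [F (fst z) * G (snd z) * H (arg x z), F (fst z) * G (snd z),
    F (fst z) * H (arg x z), G (snd z) * H (arg x z)] ! i"
  let ?N = "\<lambda>i. [enn2real (J x), A * B, A * C, B * C] ! i"
  let ?w = "\<lambda>i. [1 / s, 1 - c, 1 - b, 1 - a] ! i"
  have I: "{..<4} = {0, 1, 2, 3 :: nat}" by auto
  have "(\<integral>\<^sup>+z. (\<Prod>i<4. ?A i z powr ?w i) \<partial>(lborel \<Otimes>\<^sub>M lborel)) \<le> ennreal (\<Prod>i<4. ?N i powr ?w i)"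
  proof (rule nn_integral_Holder_prod)
    show "(\<Sum>i<4. ?w i) = 1" unfolding I using exps by simp
  next
    fix i :: nat assume "i \<in> {..<4}"
    then have i: "i = 0 \<or> i = 1 \<or> i = 2 \<or> i = 3" by auto
    then show "0 \<le> ?w i" using exps by auto
    show "?A i \<in> borel_measurable (lborel \<Otimes>\<^sub>M lborel)" using i by auto
    show "0 \<le> ?A i z" for z using i nonneg by auto
    show "0 \<le> ?N i" using i ABC by auto
    show "(\<integral>\<^sup>+z. ?A i z \<partial>(lborel \<Otimes>\<^sub>M lborel)) \<le> ennreal (?N i)"
      using i int_FG int_FH int_GH J_finite by (auto simp: J_def[symmetric])
  qed simp
  moreover have "(\<Prod>i<4. ?A i z powr ?w i)
      = F (fst z) powr a * G (snd z) powr b * H (arg x z) powr c" for z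
    unfolding I by (subst powr_Young_split[OF nonneg exps(5), symmetric]) (simp add: mult.assoc)
  moreover have "(\<Prod>i<4. ?N i powr ?w i) = enn2real (J x) powr (1 / s) * Y"
    unfolding I Y_def by (simp add: mult.assoc)
  ultimately show ?thesis
    by (simp add: signed_conv_def arg_def)
qed

lemma signed_conv_Young_finite_aux: "T x < \<infinity>"
  using T_le[of x] by (metis ennreal_less_top infinity_ennreal_def order.strict_trans1)

text \<open>Raising the pointwise bound to the power \<open>s\<close> turns
  \<open>J powr (1 / s)\<close> into \<open>J\<close> itself, whose integral is
  \<open>A * B * C\<close>.\<close>

lemma signed_conv_Young_aux:
  "(\<integral>\<^sup>+x. enn2real (T x) powr s \<partial>lborel) \<le> ennreal ((A powr a * B powr b * C powr c) powr s)"
proof -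
  have Y: "0 \<le> Y" by (simp add: Y_def)
  have "enn2real (T x) powr s \<le> enn2real (J x) * Y powr s" for x
  proof -
    have "enn2real (T x) \<le> enn2real (J x) powr (1 / s) * Y"
      using T_le[of x] Y by (intro enn2real_leI) auto
    then have "enn2real (T x) powr s \<le> (enn2real (J x) powr (1 / s) * Y) powr s"
      using exps by (intro powr_mono2) auto
    then show ?thesis
      using exps Y by (simp add: powr_mult powr_powr)
  qed
  then have "(\<integral>\<^sup>+x. enn2real (T x) powr s \<partial>lborel) \<le> (\<integral>\<^sup>+x. J x * ennreal (Y powr s) \<partial>lborel)"
    using J_finite by (intro nn_integral_mono) (metis ennreal_enn2real ennreal_leI ennreal_mult enn2real_nonneg infinity_ennreal_def powr_ge_zero)
  also have "\<dots> = ennreal (A * B * C * Y powr s)"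
    by (simp add: nn_integral_multc int_J ennreal_mult ABC)
  also have "A * B * C * Y powr s = ((A * B * C) powr (1 / s) * Y) powr s"
    using exps Y ABC by (simp add: powr_mult powr_powr)
  \<comment> \<open>The splitting of the integrand, now read backwards for the masses
    \<open>A\<close>, \<open>B\<close>, \<open>C\<close>, recombines the four factors.\<close>
  also have "(A * B * C) powr (1 / s) * Y = A powr a * B powr b * C powr c"
    using powr_Young_split[OF ABC exps(5)] by (simp add: Y_def mult.assoc)
  finally show ?thesis .
qed

end

section \<open>Transfer between a measure and its completion\<close>

lemma borel_measurable_completion_AE_eq:
  fixes f g :: "'x \<Rightarrow> 'b::topological_space"
  assumes g: "g \<in> borel_measurable M" and eq: "AE x in M. f x = g x"
  shows "f \<in> borel_measurable (completion M)"
proof (rule measurableI)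
  fix X :: "'b set" assume "X \<in> sets borel"
  then have gX: "g -` X \<inter> space M \<in> sets M"
    using g by (rule measurable_sets[rotated])
  obtain Z where Z: "Z \<in> null_sets M" "{x \<in> space M. f x \<noteq> g x} \<subseteq> Z"
    using eq by (auto simp: eventually_ae_filter)
  have "f -` X \<inter> space M = (g -` X \<inter> space M - Z) \<union> (f -` X \<inter> space M \<inter> Z)"
    using Z(2) by auto
  then have "f -` X \<inter> space M \<in> sets (completion M)"
    by (rule sets_completionI[OF _ Int_lower2 Z(1)]) (use gX Z(1) in auto)
  then show "f -` X \<inter> space (completion M) \<in> sets (completion M)" by simp
qed simp

text \<open>The exceptional set lies in a cylinder over a null set, which is null in the product.
  This allows a function of one variable to be replaced by a representative inside a double
  integral.\<close>

lemma AE_lborel_fst: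
  assumes "AE x in lborel. P x"
  shows "AE z in (lborel :: ('a::euclidean_space \<times> 'b::euclidean_space) measure). P (fst z)"
proof -
  obtain N where N: "N \<in> null_sets lborel" "{x. \<not> P x} \<subseteq> N"
    using assms by (auto simp: eventually_ae_filter)
  have "N \<times> UNIV \<in> null_sets (lborel \<Otimes>\<^sub>M (lborel :: 'b measure))"
    using N(1) by (intro lborel.times_in_null_sets1) auto
  then show ?thesis
    using N(2) unfolding lborel_prod by (intro AE_I'[of "N \<times> UNIV"]) auto
qed

lemma AE_lborel_snd:
  assumes "AE x in lborel. P x"
  shows "AE z in (lborel :: ('a::euclidean_space \<times> 'b::euclidean_space) measure). P (snd z)"
proof -
  obtain N where N: "N \<in> null_sets lborel" "{x. \<not> P x} \<subseteq> N"
    using assms by (auto simp: eventually_ae_filter)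
  have "UNIV \<times> N \<in> null_sets ((lborel :: 'a measure) \<Otimes>\<^sub>M lborel)"
    using N(1) by (intro lborel.times_in_null_sets2) auto
  then show ?thesis
    using N(2) unfolding lborel_prod by (intro AE_I'[of "UNIV \<times> N"]) auto
qed

text \<open>Lebesgue measure on the plane is the completion of a product measure; this moves
  integrals over it to \<open>lborel\<close>, where Tonelli applies to Borel
  representatives.\<close>

lemma completion_AE_eq:
  fixes f g :: "'x \<Rightarrow> 'b::{banach, second_countable_topology}"
  assumes g [measurable]: "g \<in> borel_measurable M" and eq: "AE x in M. f x = g x"
  shows integrable_completion_AE_eq: "integrable (completion M) f \<longleftrightarrow> integrable M g"
    and integral_completion_AE_eq: "integral\<^sup>L (completion M) f = integral\<^sup>L M g"
proof -
  have meas: "f \<in> borel_measurable (completion M)" "g \<in> borel_measurable (completion M)"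
    using borel_measurable_completion_AE_eq[OF g eq] measurable_completion[OF g] by auto
  have eq': "AE x in completion M. f x = g x"
    using eq by (rule AE_completion)
  show "integrable (completion M) f \<longleftrightarrow> integrable M g"
    using integrable_cong_AE[OF meas eq'] integrable_completion[OF g] by simp
  show "integral\<^sup>L (completion M) f = integral\<^sup>L M g"
    using integral_cong_AE[OF meas eq'] integral_completion[OF g] by simp
qed

section \<open>Lebesgue spaces and their norms\<close>

lemma Lp_space_I:
  assumes h: "h \<in> borel_measurable lebesgue" and "1 \<le> s" "0 \<le> N"
    and le: "(\<integral>\<^sup>+x. norm (h x) powr s \<partial>lborel) \<le> ennreal (N powr s)"
  shows "h \<in> Lp_space s" "Lp_norm s h \<le> N"
proof -
  have [measurable]: "(\<lambda>x. norm (h x) powr s) \<in> borel_measurable lebesgue"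
    using h by measurable
  have le': "(\<integral>\<^sup>+x. norm (h x) powr s \<partial>lebesgue) \<le> ennreal (N powr s)"
    using le by (simp add: nn_integral_completion)
  then have int: "integrable lebesgue (\<lambda>x. norm (h x) powr s)"
    by (intro integrableI_bounded) (auto intro: order.strict_trans1)
  then show "h \<in> Lp_space s"
    using h by (simp add: Lp_space_def)
  have "(LINT x|lebesgue. norm (h x) powr s) \<le> N powr s"
    using le' nn_integral_eq_integral[OF int] by simp
  then have "Lp_norm s h \<le> (N powr s) powr (1 / s)"
    unfolding Lp_norm_def using assms(2) by (intro powr_mono2) auto
  then show "Lp_norm s h \<le> N"
    using assms(2,3) by (simp add: powr_powr)
qed

lemma Lp_norm_nonneg: "0 \<le> Lp_norm p f"
  by (simp add: Lp_norm_def)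

lemma Lp_norm_powr:
  assumes "p \<noteq> 0"
  shows "Lp_norm p f powr p = (LINT x|lebesgue. norm (f x) powr p)"
  using assms by (simp add: Lp_norm_def powr_powr)

lemma Lp_space_representative:
  fixes f :: "real \<Rightarrow> 'b::{real_normed_vector, second_countable_topology}"
  assumes f: "f \<in> Lp_space p" and "1 \<le> p"
  obtains g where "g \<in> borel_measurable borel" "AE x in lborel. f x = g x"
    "(\<integral>\<^sup>+x. norm (g x) powr p \<partial>lborel) = ennreal (Lp_norm p f powr p)"
proof -
  obtain g where g: "g \<in> borel_measurable lborel" "AE x in lborel. f x = g x"
    using f completion_ex_borel_measurable_second_countable[of f lborel]
    by (auto simp: Lp_space_def)
  have "(\<integral>\<^sup>+x. norm (g x) powr p \<partial>lborel) = (\<integral>\<^sup>+x. norm (f x) powr p \<partial>lborel)"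
    using g(2) by (intro nn_integral_cong_AE) auto
  also have "\<dots> = (\<integral>\<^sup>+x. norm (f x) powr p \<partial>lebesgue)"
    by (simp add: nn_integral_completion)
  also have "\<dots> = ennreal (Lp_norm p f powr p)"
    using f assms(2) by (subst nn_integral_eq_integral) (auto simp: Lp_space_def Lp_norm_powr)
  finally show ?thesis
    using g by (intro that) auto
qed

section \<open>The Gaussian weight\<close>

lemma gauss_weight_measurable [measurable]: "gauss_weight \<in> borel_measurable borel"
  unfolding gauss_weight_def by measurable

text \<open>The power is \<open>sqrt (2 * pi / r)\<close> times the centred normal density with
  standard deviation \<open>1 / sqrt r\<close>, which has mass 1.\<close>

lemma nn_integral_gauss_weight_powr:
  assumes "0 < r"
  shows "(\<integral>\<^sup>+x. gauss_weight x powr r \<partial>lborel) = ennreal (sqrt (2 * pi / r))"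
proof -
  have "gauss_weight x powr r = sqrt (2 * pi / r) * normal_density 0 (1 / sqrt r) x" for x
    using assms
    by (simp add: gauss_weight_def normal_density_def powr_def power_divide real_sqrt_divide)
  then have "(\<integral>\<^sup>+x. gauss_weight x powr r \<partial>lborel)
      = ennreal (sqrt (2 * pi / r)) * (\<integral>\<^sup>+x. normal_density 0 (1 / sqrt r) x \<partial>lborel)"
    using assms by (simp add: ennreal_mult nn_integral_cmult)
  also have "(\<integral>\<^sup>+x. normal_density 0 (1 / sqrt r) x \<partial>lborel) = 1"
    using assms by (subst nn_integral_eq_integral) auto
  finally show ?thesis by simp
qed

lemma gauss_weight_Lp_space:
  assumes "1 \<le> r"
  shows "gauss_weight \<in> Lp_space r"
  using assms nn_integral_gauss_weight_powr[of r]
  by (intro Lp_space_I[where N = "sqrt (2 * pi / r) powr (1 / r)"] measurable_completion)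
    (auto simp: powr_powr gauss_weight_def)

section \<open>Young's inequality in terms of norms\<close>

text \<open>The case \<open>F = f powr p\<close>, \<open>G = g powr q\<close>,
  \<open>H = h powr r\<close>; nonnegativity makes the powers with reciprocal exponents return
  \<open>f\<close>, \<open>g\<close>, \<open>h\<close>.\<close>

lemma signed_conv_Young:
  fixes f g h :: "real \<Rightarrow> real"
  assumes meas [measurable]: "f \<in> borel_measurable borel" "g \<in> borel_measurable borel"
      "h \<in> borel_measurable borel"
    and nonneg: "\<And>x. 0 \<le> f x" "\<And>x. 0 \<le> g x" "\<And>x. 0 \<le> h x" and bound: "\<And>x. h x \<le> K"
    and ABC: "0 \<le> A" "0 \<le> B" "0 \<le> C"
    and int: "(\<integral>\<^sup>+x. f x powr p \<partial>lborel) = ennreal (A powr p)"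
      "(\<integral>\<^sup>+x. g x powr q \<partial>lborel) = ennreal (B powr q)"
      "(\<integral>\<^sup>+x. h x powr r \<partial>lborel) = ennreal (C powr r)"
    and exps: "1 \<le> p" "1 \<le> q" "1 \<le> r" "1 \<le> s" "1 / p + 1 / q + 1 / r = 2 + 1 / s"
    and signs: "\<bar>\<epsilon>\<bar> = 1" "\<bar>\<delta>\<bar> = 1"
  shows signed_conv_Young_finite: "signed_conv \<epsilon> \<delta> f g h x < \<infinity>"
    and signed_conv_Young_powr:
      "(\<integral>\<^sup>+x. enn2real (signed_conv \<epsilon> \<delta> f g h x) powr s \<partial>lborel) \<le> ennreal ((A * B * C) powr s)"
proof -
  have eqs: "(\<lambda>x. (f x powr p) powr (1 / p)) = f" "(\<lambda>x. (g x powr q) powr (1 / q)) = g"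
    "(\<lambda>x. (h x powr r) powr (1 / r)) = h" "(A powr p) powr (1 / p) = A"
    "(B powr q) powr (1 / q) = B" "(C powr r) powr (1 / r) = C"
    using exps nonneg ABC by (auto simp: powr_powr)
  have m: "(\<lambda>x. f x powr p) \<in> borel_measurable borel" "(\<lambda>x. g x powr q) \<in> borel_measurable borel"
    "(\<lambda>x. h x powr r) \<in> borel_measurable borel" by measurable
  have b: "h x powr r \<le> K powr r" for x
    using bound nonneg exps by (intro powr_mono2) auto
  have e: "1 / p \<le> 1" "1 / q \<le> 1" "1 / r \<le> 1" using exps by auto
  note Y = m powr_ge_zero powr_ge_zero powr_ge_zero b powr_ge_zero powr_ge_zero powr_ge_zero
    int e exps(4,5) signs
  show "signed_conv \<epsilon> \<delta> f g h x < \<infinity>"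
    using signed_conv_Young_finite_aux[OF Y] unfolding eqs .
  show "(\<integral>\<^sup>+x. enn2real (signed_conv \<epsilon> \<delta> f g h x) powr s \<partial>lborel) \<le> ennreal ((A * B * C) powr s)"
    using signed_conv_Young_aux[OF Y] unfolding eqs .
qed

section \<open>The integrand of the convolution\<close>

abbreviation signs :: "(real \<times> real) set" where
  "signs \<equiv> {1, -1} \<times> {1, -1}"

lemma cos_conv_integrand_measurable [measurable]:
  fixes f g :: "real \<Rightarrow> 'a::{real_normed_field, second_countable_topology}"
  assumes [measurable]: "f \<in> borel_measurable borel" "g \<in> borel_measurable borel"
  shows "(\<lambda>(x, z). cos_conv_integrand f g x z) \<in> borel_measurable (borel \<Otimes>\<^sub>M (borel \<Otimes>\<^sub>M borel))"
  unfolding cos_conv_integrand_def conv_kernel_def by measurable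

lemma cos_conv_integrand_cong_AE:
  assumes "AE x in lborel. f x = f' x" "AE x in lborel. g x = g' x"
  shows "AE z in lborel. cos_conv_integrand f g x z = cos_conv_integrand f' g' x z"
  using AE_lborel_fst[OF assms(1), where 'b = real] AE_lborel_snd[OF assms(2), where 'a = real]
  by eventually_elim (simp add: cos_conv_integrand_def split_beta)

text \<open>The kernel is nonnegative, so the norm of the integrand is the product of the norms with
  the kernel, which splits into its four Gaussians. This serves both integrability and the pointwise
  bound.\<close>

lemma nn_integral_norm_cos_conv_integrand:
  fixes f g :: "real \<Rightarrow> 'a::{real_normed_field, second_countable_topology}"
  assumes [measurable]: "f \<in> borel_measurable borel" "g \<in> borel_measurable borel"
  shows "(\<integral>\<^sup>+z. norm (cos_conv_integrand f g x z) \<partial>lborel)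
    = (\<Sum>(\<epsilon>, \<delta>)\<in>signs. signed_conv \<epsilon> \<delta> (\<lambda>u. norm (f u)) (\<lambda>v. norm (g v)) gauss_weight x)"
proof -
  have g0: "0 \<le> gauss_weight y" for y by (simp add: gauss_weight_def)
  have "norm (cos_conv_integrand f g x z)
      = norm (f (fst z)) * norm (g (snd z)) * conv_kernel x (fst z) (snd z)" for z
    using g0 by (simp add: cos_conv_integrand_def conv_kernel_def split_beta norm_mult)
  also have "\<dots> z = (\<Sum>(\<epsilon>, \<delta>)\<in>signs. norm (f (fst z)) * norm (g (snd z))
          * gauss_weight (x + \<epsilon> * fst z + \<delta> * snd z))" for z
    by (simp add: conv_kernel_def sum.cartesian_product[symmetric] algebra_simps)
  finally have "ennreal (norm (cos_conv_integrand f g x z))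
      = (\<Sum>(\<epsilon>, \<delta>)\<in>signs. ennreal (norm (f (fst z)) * norm (g (snd z))
          * gauss_weight (x + \<epsilon> * fst z + \<delta> * snd z)))" for z
    using g0 by (simp add: split_beta sum_ennreal)
  then show ?thesis
    by (simp add: signed_conv_def lborel_prod[symmetric] split_beta nn_integral_add)
qed

section \<open>Existence of the convolution and its norm bound\<close>

theorem corollary2p1:
  fixes p q r s :: real
    and f g :: "real \<Rightarrow> 'a::{real_normed_field, banach, second_countable_topology}"
  assumes "p \<ge> 1" and "q \<ge> 1" and "r \<ge> 1" and "s \<ge> 1"
    and "1 / p + 1 / q + 1 / r = 2 + 1 / s"
    and "f \<in> Lp_space p" and "g \<in> Lp_space q"
  shows "gauss_weight \<in> Lp_space r
    \<and> (\<forall>x. integrable lebesgue (cos_conv_integrand f g x))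
    \<and> cos_conv f g \<in> Lp_space s
    \<and> Lp_norm s (cos_conv f g)
        \<le> 1 / (2 * pi) * sqrt (2 * pi / r) powr (1 / r) * Lp_norm p f * Lp_norm q g"
proof -
  obtain f' where f' [measurable]: "f' \<in> borel_measurable borel"
    and ff': "AE x in lborel. f x = f' x"
    and intf: "(\<integral>\<^sup>+x. norm (f' x) powr p \<partial>lborel) = ennreal (Lp_norm p f powr p)"
    using Lp_space_representative[OF assms(6,1)] .
  obtain g' where g' [measurable]: "g' \<in> borel_measurable borel"
    and gg': "AE x in lborel. g x = g' x"
    and intg: "(\<integral>\<^sup>+x. norm (g' x) powr q \<partial>lborel) = ennreal (Lp_norm q g powr q)"
    using Lp_space_representative[OF assms(7,2)] .
  \<comment> \<open>\<open>C\<close> is the \<open>r\<close>-norm of the Gaussian, and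
    \<open>A\<close> is the bound that Young's inequality gives for each of the four terms.\<close>
  define C where "C = sqrt (2 * pi / r) powr (1 / r)"
  define A where "A = Lp_norm p f * Lp_norm q g * C"
  define T where "T = (\<lambda>(\<epsilon>, \<delta>). signed_conv \<epsilon> \<delta> (\<lambda>u. norm (f' u)) (\<lambda>v. norm (g' v)) gauss_weight)"
  define J :: "(real \<times> real) set" where "J = signs"
  have J: "finite J" "J \<noteq> {}" "card J = 4"
    by (simp_all add: J_def card_cartesian_product)
  have A0: "0 \<le> A" by (simp add: A_def C_def Lp_norm_nonneg)
  have intC: "(\<integral>\<^sup>+x. gauss_weight x powr r \<partial>lborel) = ennreal (C powr r)"
    using nn_integral_gauss_weight_powr[of r] assms(3) by (simp add: C_def powr_powr)
  have mf: "(\<lambda>u. norm (f' u)) \<in> borel_measurable borel" "(\<lambda>v. norm (g' v)) \<in> borel_measurable borel"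
    by measurable
  have gw: "0 \<le> gauss_weight y" "gauss_weight y \<le> 1" for y
    by (simp_all add: gauss_weight_def)
  have T: "T j x < \<infinity>" "(\<integral>\<^sup>+x. enn2real (T j x) powr s \<partial>lborel) \<le> ennreal (A powr s)"
    if js: "j \<in> J" for j x
  proof -
    obtain \<epsilon> \<delta> where j: "j = (\<epsilon>, \<delta>)" "\<bar>\<epsilon>\<bar> = 1" "\<bar>\<delta>\<bar> = 1"
      using js by (cases j) (auto simp: J_def)
    note Y = mf gauss_weight_measurable norm_ge_zero norm_ge_zero gw Lp_norm_nonneg Lp_norm_nonneg _
      intf intg intC assms(1-5) j(2,3)
    have C0: "0 \<le> C" by (simp add: C_def)
    show "T j x < \<infinity>"
      using signed_conv_Young_finite[OF Y] C0 by (simp add: T_def j(1))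
    show "(\<integral>\<^sup>+x. enn2real (T j x) powr s \<partial>lborel) \<le> ennreal (A powr s)"
      using signed_conv_Young_powr[OF Y] C0 by (simp add: T_def j(1) A_def)
  qed
  have T_meas [measurable]: "T j \<in> borel_measurable borel" for j
    unfolding T_def signed_conv_def by (cases j) simp
  have norm_int: "(\<integral>\<^sup>+z. norm (cos_conv_integrand f' g' x z) \<partial>lborel)
      = ennreal (\<Sum>j\<in>J. enn2real (T j x))" for x
  proof -
    have "(\<integral>\<^sup>+z. norm (cos_conv_integrand f' g' x z) \<partial>lborel) = (\<Sum>j\<in>J. T j x)"
      by (simp add: nn_integral_norm_cos_conv_integrand T_def J_def split_beta)
    also have "\<dots> = (\<Sum>j\<in>J. ennreal (enn2real (T j x)))"
      using T(1) by (intro sum.cong) auto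
    also have "\<dots> = ennreal (\<Sum>j\<in>J. enn2real (T j x))"
      by (rule sum_ennreal) simp
    finally show ?thesis .
  qed
  have meas': "cos_conv_integrand f' g' x \<in> borel_measurable lborel" for x
    using measurable_Pair2[OF cos_conv_integrand_measurable[OF f' g'], of x]
    by (simp add: borel_prod)
  have int': "integrable lborel (cos_conv_integrand f' g' x)" for x
    using norm_int[of x] meas' by (intro integrableI_bounded) auto
  note ae = cos_conv_integrand_cong_AE[OF ff' gg']
  have int: "integrable lebesgue (cos_conv_integrand f g x)" for x
    using int' integrable_completion_AE_eq[OF meas' ae] by blast
  \<comment> \<open>For each \<open>x\<close> the integrands of \<open>f, g\<close> and
    \<open>f', g'\<close> agree almost everywhere in the plane, so the convolutions agree at every
    \<open>x\<close>. This makes \<open>cos_conv f g\<close> Borel measurable.\<close>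
  have conv_eq: "cos_conv f g x = (1 / (8 * pi)) *\<^sub>R integral\<^sup>L lborel (cos_conv_integrand f' g' x)" for x
    unfolding cos_conv_def integral_completion_AE_eq[OF meas' ae] ..
  have conv_meas: "cos_conv f g \<in> borel_measurable borel"
  proof -
    have "(\<lambda>x. integral\<^sup>L lborel (cos_conv_integrand f' g' x)) \<in> borel_measurable borel"
      using cos_conv_integrand_measurable[OF f' g']
      by (intro lborel.borel_measurable_lebesgue_integral)
        (simp add: borel_prod measurable_cong_sets[OF sets_pair_measure_cong[OF refl sets_lborel] refl])
    then show ?thesis
      unfolding conv_eq by measurable
  qed
  have norm_le: "norm (cos_conv f g x) powr s
      \<le> (1 / (2 * pi)) powr s * ((\<Sum>j\<in>J. enn2real (T j x) powr s) / card J)" for x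
  proof -
    have "ennreal (norm (integral\<^sup>L lborel (cos_conv_integrand f' g' x)))
        \<le> ennreal (\<Sum>j\<in>J. enn2real (T j x))"
      unfolding norm_int[symmetric] by (rule integral_norm_bound_ennreal[OF int'])
    then have "norm (integral\<^sup>L lborel (cos_conv_integrand f' g' x)) \<le> (\<Sum>j\<in>J. enn2real (T j x))"
      by (subst (asm) ennreal_le_iff) (auto intro: sum_nonneg)
    \<comment> \<open>The factor \<open>1 / (8 * pi)\<close> times a sum of four terms is
      \<open>1 / (2 * pi)\<close> times their mean, to which Jensen's inequality applies.\<close>
    then have "norm (cos_conv f g x) \<le> 1 / (2 * pi) * ((\<Sum>j\<in>J. enn2real (T j x)) / card J)"
      unfolding conv_eq by (simp add: J(3) field_simps)
    then have "norm (cos_conv f g x) powr s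
        \<le> (1 / (2 * pi) * ((\<Sum>j\<in>J. enn2real (T j x)) / card J)) powr s"
      using assms(4) by (intro powr_mono2) auto
    also have "\<dots> = (1 / (2 * pi)) powr s * ((\<Sum>j\<in>J. enn2real (T j x)) / card J) powr s"
      by (rule powr_mult)
    also have "\<dots> \<le> (1 / (2 * pi)) powr s * ((\<Sum>j\<in>J. enn2real (T j x) powr s) / card J)"
      using assms(4) by (intro mult_left_mono powr_mean_le J) auto
    finally show ?thesis .
  qed
  have "(\<integral>\<^sup>+x. norm (cos_conv f g x) powr s \<partial>lborel)
      \<le> (\<integral>\<^sup>+x. ennreal ((1 / (2 * pi)) powr s / card J) * (\<Sum>j\<in>J. ennreal (enn2real (T j x) powr s)) \<partial>lborel)"
    using norm_le by (intro nn_integral_mono) (simp add: ennreal_mult[symmetric] sum_ennreal sum_nonneg ennreal_leI)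
  also have "\<dots> = ennreal ((1 / (2 * pi)) powr s / card J)
      * (\<Sum>j\<in>J. \<integral>\<^sup>+x. ennreal (enn2real (T j x) powr s) \<partial>lborel)"
    by (simp add: nn_integral_cmult nn_integral_sum del: sum_ennreal)
  also have "\<dots> \<le> ennreal ((1 / (2 * pi)) powr s / card J) * (\<Sum>j\<in>J. ennreal (A powr s))"
    using T(2) by (intro mult_left_mono sum_mono) auto
  \<comment> \<open>All four terms share the bound \<open>A powr s\<close>, so averaging them costs
    no constant.\<close>
  also have "\<dots> = ennreal ((1 / (2 * pi) * A) powr s)"
    by (subst powr_mult, subst sum_ennreal) (simp_all add: ennreal_mult[symmetric] J(3))
  finally have bound: "(\<integral>\<^sup>+x. norm (cos_conv f g x) powr s \<partial>lborel) \<le> ennreal ((1 / (2 * pi) * A) powr s)" .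
  have "cos_conv f g \<in> borel_measurable lebesgue"
    using conv_meas by (intro measurable_completion) simp
  then have "cos_conv f g \<in> Lp_space s" "Lp_norm s (cos_conv f g) \<le> 1 / (2 * pi) * A"
    using Lp_space_I[OF _ assms(4) _ bound] A0 by auto
  then show ?thesis
    using gauss_weight_Lp_space[OF assms(3)] int by (simp add: A_def C_def mult_ac)
qed

end
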